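(* There exists an absolute constant $C>0$ such that the following holds. Let $d\ge 1$ and $n\ge 8$ be integers, and let $f_1,\dots,f_n\colon [0,1]^d\to[-1,1]$ be continuous functions. For $i,j\in\{1,\dots,n\}$ put $$D(i,j):=\int_{[0,1]^d}|f_i(x)-f_j(x)|^2\,\mathrm{d}x .$$ Then for every $\varepsilon\in(0,1)$ there exist an integer $k\le C\,\frac{\ln n}{\varepsilon^2}$ and maps $\mathrm{Enc}\colon C([0,1]^d)\to\mathbb{R}^k$ and $\mathrm{Dec}\colon \mathbb{R}^k\times\mathbb{R}^k\to\mathbb{R}$ such that for all $i,j\in\{1,\dots,n\}$, $$\bigl|\mathrm{Dec}(\mathrm{Enc}(f_i),\mathrm{Enc}(f_j))-D(i,j)\bigr|\le\varepsilon .$$ Moreover, one may take $\mathrm{Dec}(u,v)=|u-v|^2$ (the squared Euclidean distance in $\mathbb{R}^k$) and $\mathrm{Enc}$ to be linear.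
   Context: $C([0,1]^d)$ denotes the vector space of continuous real-valued functions on $[0,1]^d$; $|\cdot|$ on $\mathbb{R}^k$ is the Euclidean norm. The maps $\mathrm{Enc}$ and $\mathrm{Dec}$ (and $k$) may depend on $f_1,\dots,f_n$ and $\varepsilon$. The constant $C$ does not depend on $d$, $n$, $\varepsilon$ or the functions. *)

theory Defs
  imports "HOL-Analysis.Analysis"
begin

text \<open>
  Dimensions are quantified inside the theorem (the constant must not depend on them), so points
  of \<open>\<real>\<^sup>m\<close> are functions on the index set \<open>{..<m}\<close>, extended by \<open>undefined\<close> elsewhere. This is
  the carrier of the product measure \<open>\<Pi>\<^sub>M i\<in>{..<m}. lborel\<close>, i.e. of Lebesgue measure on \<open>\<real>\<^sup>m\<close>.
  On it the product topology of the type \<open>nat \<Rightarrow> real\<close>, which is the one used by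
  \<open>continuous_on\<close>, is the usual Euclidean topology.
\<close>

definition real_vecs :: "nat \<Rightarrow> (nat \<Rightarrow> real) set" where
  "real_vecs m = {..<m} \<rightarrow>\<^sub>E UNIV"

definition unit_cube :: "nat \<Rightarrow> (nat \<Rightarrow> real) set" where
  "unit_cube d = {..<d} \<rightarrow>\<^sub>E {0..1}"

text \<open>Being \<open>extensional\<close> makes an element of \<open>C([0,1]\<^sup>d)\<close> determined by its values on the cube.\<close>

definition cont_cube :: "nat \<Rightarrow> ((nat \<Rightarrow> real) \<Rightarrow> real) set" where
  "cont_cube d = {f \<in> extensional (unit_cube d). continuous_on (unit_cube d) f}"

definition euclid_dist :: "nat \<Rightarrow> (nat \<Rightarrow> real) \<Rightarrow> (nat \<Rightarrow> real) \<Rightarrow> real" where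
  "euclid_dist k u v = L2_set (\<lambda>l. u l - v l) {..<k}"

definition sq_L2_dist ::
    "nat \<Rightarrow> ((nat \<Rightarrow> real) \<Rightarrow> real) \<Rightarrow> ((nat \<Rightarrow> real) \<Rightarrow> real) \<Rightarrow> real" where
  "sq_L2_dist d f g =
     (LINT x : unit_cube d | (\<Pi>\<^sub>M i\<in>{..<d}. lborel). \<bar>f x - g x\<bar>\<^sup>2)"

text \<open>
  The vector space operations are pointwise; the restrictions bring the results back to the
  extensional representatives in \<open>cont_cube d\<close> and \<open>real_vecs k\<close>.
\<close>

definition linear_enc ::
    "nat \<Rightarrow> nat \<Rightarrow> (((nat \<Rightarrow> real) \<Rightarrow> real) \<Rightarrow> nat \<Rightarrow> real) \<Rightarrow> bool" where
  "linear_enc d k E \<longleftrightarrow>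
     (\<forall>f\<in>cont_cube d. \<forall>g\<in>cont_cube d.
        E (\<lambda>x\<in>unit_cube d. f x + g x) = (\<lambda>l\<in>{..<k}. E f l + E g l)) \<and>
     (\<forall>c. \<forall>f\<in>cont_cube d.
        E (\<lambda>x\<in>unit_cube d. c * f x) = (\<lambda>l\<in>{..<k}. c * E f l))"

end

theory Submission
  imports Defs "HOL-Probability.Hoeffding"
begin

text \<open>
  No general Johnson--Lindenstrauss argument is needed: since the functions are bounded, point
  evaluation at \<open>k\<close> sample points, scaled by \<open>1 / sqrt k\<close>, is a suitable linear encoder. By
  Hoeffding's lemma, random samples estimate all the means \<open>D(i,j)\<close> simultaneously within
  \<open>\<epsilon>\<close> once \<open>k\<close> is of order \<open>ln n / \<epsilon>\<^sup>2\<close>. To avoid the product of the sample space with itself, the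
  points are chosen one after the other, each step multiplying the exponential potential
  \<open>\<Sum> (exp (\<lambda>S) + exp (-\<lambda>S))\<close> by no more than the bound of Hoeffding's lemma.
\<close>

section \<open>Sample means of bounded random variables\<close>

context prob_space
begin

text \<open>Hoeffding's lemma for \<open>s > 0\<close>, applied also to \<open>- X\<close> with
  values in \<open>[-b, -a]\<close>, covers both signs of \<open>s\<close>. Integrability holds
  because the exponent is bounded. It is stated as well because the later averaging step needs
  it.\<close>

lemma expectation_exp_centered_le:
  fixes X :: "'a \<Rightarrow> real"
  assumes X [measurable]: "X \<in> borel_measurable M" and "\<And>x. x \<in> space M \<Longrightarrow> X x \<in> {a..b}"
  shows "integrable M (\<lambda>x. exp (s * (X x - expectation X)))" (is ?I)
    and "expectation (\<lambda>x. exp (s * (X x - expectation X))) \<le> exp (s\<^sup>2 * (b - a)\<^sup>2 / 8)" (is ?E)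
proof -
  have int: "integrable M (\<lambda>x. exp (s * (X x - expectation X)))" for s
  proof (rule integrable_const_bound)
    have "s * (X x - expectation X) \<le> \<bar>s\<bar> * (\<bar>a\<bar> + \<bar>b\<bar> + \<bar>expectation X\<bar>)" if "x \<in> space M" for x
    proof -
      have "s * (X x - expectation X) \<le> \<bar>s\<bar> * \<bar>X x - expectation X\<bar>"
        by (metis abs_ge_self abs_mult)
      also have "\<dots> \<le> \<bar>s\<bar> * (\<bar>a\<bar> + \<bar>b\<bar> + \<bar>expectation X\<bar>)"
        using assms(2)[OF that] by (intro mult_left_mono) auto
      finally show ?thesis .
    qed
    then show "AE x in M. norm (exp (s * (X x - expectation X)))
        \<le> exp (\<bar>s\<bar> * (\<bar>a\<bar> + \<bar>b\<bar> + \<bar>expectation X\<bar>))"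
      by (intro AE_I2) simp
  qed simp
  show ?I by (rule int)
  interpret A: interval_bounded_random_variable M X a b
    using assms by unfold_locales (auto intro!: AE_I2)
  interpret B: interval_bounded_random_variable M "\<lambda>x. - X x" "-b" "-a"
    using assms(2) by unfold_locales (auto intro!: AE_I2)
  have "ennreal (expectation (\<lambda>x. exp (s * (X x - expectation X))))
      = (\<integral>\<^sup>+ x. exp (s * (X x - expectation X)) \<partial>M)"
    by (subst nn_integral_eq_integral) (use int in auto)
  also have "\<dots> \<le> ennreal (exp (s\<^sup>2 * (b - a)\<^sup>2 / 8))"
  proof (cases s "0 :: real" rule: linorder_cases)
    case greater
    then show ?thesis by (rule A.Hoeffdings_lemma_nn_integral)
  next
    case equal
    then show ?thesis by (simp add: emeasure_space_1)
  next
    case less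
    then show ?thesis
      using B.Hoeffdings_lemma_nn_integral[of "-s"] by (simp add: algebra_simps)
  qed
  finally show ?E by simp
qed

text \<open>If \<open>g\<close> exceeded its mean everywhere, its expectation would be strictly
  larger than itself.\<close>

lemma exists_le_expectation:
  fixes g :: "'a \<Rightarrow> real"
  assumes "integrable M g"
  obtains x where "x \<in> space M" "g x \<le> expectation g"
  using expectation_greater[OF assms, of "expectation g"] by (meson AE_I2 less_irrefl not_le)

lemma exists_sample_potential_le:
  fixes X :: "'t \<Rightarrow> 'a \<Rightarrow> real" and k :: nat
  assumes X: "\<And>t. t \<in> T \<Longrightarrow> X t \<in> borel_measurable M"
    and ab: "\<And>t x. t \<in> T \<Longrightarrow> x \<in> space M \<Longrightarrow> X t x \<in> {a..b}"
  defines "S \<equiv> \<lambda>k p t. \<Sum>l<k. X t (p l) - expectation (X t)"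
  shows "\<exists>p\<in>{..<k} \<rightarrow> space M. (\<Sum>t\<in>T. exp (s * S k p t) + exp (- s * S k p t))
           \<le> 2 * card T * exp (k * (s\<^sup>2 * (b - a)\<^sup>2 / 8))"
proof (induction k)
  case 0
  show ?case by (simp add: S_def)
next
  case (Suc k)
  define H where "H = exp (s\<^sup>2 * (b - a)\<^sup>2 / 8)"
  define Y where "Y r t x = exp (r * (X t x - expectation (X t)))" for r t x
  obtain p where p: "p \<in> {..<k} \<rightarrow> space M" 
    "(\<Sum>t\<in>T. exp (s * S k p t) + exp (- s * S k p t)) \<le> 2 * card T * exp (k * (s\<^sup>2 * (b - a)\<^sup>2 / 8))"
    using Suc by blast
  \<comment> \<open>\<open>g x\<close> is the potential after \<open>x\<close> is added as the
    sample point with index \<open>k\<close>: each summand gains a factor whose mean is at most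
    \<open>H\<close>.\<close>
  define g where "g x = (\<Sum>t\<in>T. exp (s * S k p t) * Y s t x + exp (- s * S k p t) * Y (- s) t x)" for x
  have Y: "integrable M (Y r t)" "expectation (Y r t) \<le> exp (r\<^sup>2 * (b - a)\<^sup>2 / 8)" if "t \<in> T" for r t
    using expectation_exp_centered_le[OF X ab, OF that that, of r] unfolding Y_def by auto
  have "integrable M g"
    unfolding g_def using Y by (intro Bochner_Integration.integrable_sum) auto
  then obtain x where x: "x \<in> space M" "g x \<le> expectation g"
    by (rule exists_le_expectation)
  have "expectation g = (\<Sum>t\<in>T. exp (s * S k p t) * expectation (Y s t)
      + exp (- s * S k p t) * expectation (Y (- s) t))"
    unfolding g_def using Y by (subst Bochner_Integration.integral_sum) auto
  also have "\<dots> \<le> (\<Sum>t\<in>T. exp (s * S k p t) * H + exp (- s * S k p t) * H)"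
    using Y(2)[of _ s] Y(2)[of _ "- s"] unfolding H_def
    by (intro sum_mono add_mono mult_left_mono) auto
  also have "\<dots> = (\<Sum>t\<in>T. exp (s * S k p t) + exp (- s * S k p t)) * H"
    by (simp add: sum_distrib_right distrib_right)
  also have "\<dots> \<le> 2 * card T * exp (k * (s\<^sup>2 * (b - a)\<^sup>2 / 8)) * H"
    using p(2) by (intro mult_right_mono) (auto simp: H_def)
  also have "\<dots> = 2 * card T * exp (Suc k * (s\<^sup>2 * (b - a)\<^sup>2 / 8))"
    unfolding H_def mult.assoc exp_add[symmetric] by (simp add: algebra_simps add_divide_distrib)
  finally have le: "g x \<le> 2 * card T * exp (Suc k * (s\<^sup>2 * (b - a)\<^sup>2 / 8))"
    using x(2) by simp
  \<comment> \<open>\<open>S k p\<close> only reads \<open>p\<close> below \<open>k\<close>, so the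
    update at \<open>k\<close> leaves the old terms alone and appends one.\<close>
  have "S (Suc k) (p(k := x)) t = S k p t + (X t x - expectation (X t))" for t
    by (simp add: S_def)
  then have eq: "(\<Sum>t\<in>T. exp (s * S (Suc k) (p(k := x)) t) + exp (- s * S (Suc k) (p(k := x)) t)) = g x"
    by (simp only: g_def Y_def distrib_left exp_add)
  have "p(k := x) \<in> {..<Suc k} \<rightarrow> space M"
    using p(1) x(1) by (auto simp: less_Suc_eq)
  then show ?case using le unfolding eq[symmetric] by (intro bexI[of _ "p(k := x)"])
qed

text \<open>The potential bounds each of its summands, so taking logarithms gives \<open>s * \<bar>S
  p t\<bar> \<le> ln (2 * card T) + k * (s\<^sup>2 * (b - a)\<^sup>2 / 8)\<close>. For the chosen
  \<open>s\<close> the second term equals \<open>s * k * \<delta> / 2\<close>, and the assumption on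
  \<open>k\<close> bounds the first by the same amount.\<close>

lemma exists_sample_mean_close:
  fixes X :: "'t \<Rightarrow> 'a \<Rightarrow> real"
  assumes "finite T"
    and X: "\<And>t. t \<in> T \<Longrightarrow> X t \<in> borel_measurable M"
    and ab: "\<And>t x. t \<in> T \<Longrightarrow> x \<in> space M \<Longrightarrow> X t x \<in> {a..b}"
    and "a < b" "0 < k" "0 < \<delta>" and k: "ln (2 * card T) * (b - a)\<^sup>2 \<le> 2 * k * \<delta>\<^sup>2"
  shows "\<exists>p\<in>{..<k::nat} \<rightarrow> space M. \<forall>t\<in>T. \<bar>(\<Sum>l<k. X t (p l)) / k - expectation (X t)\<bar> \<le> \<delta>"
proof -
  \<comment> \<open>minimises \<open>k s\<^sup>2 (b - a)\<^sup>2 / 8 - s k \<delta>\<close>\<close>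
  define s where "s = 4 * \<delta> / (b - a)\<^sup>2"
  have "s > 0" using assms by (simp add: s_def)
  define S where "S p t = (\<Sum>l<k. X t (p l) - expectation (X t))" for p t
  obtain p where p: "p \<in> {..<k} \<rightarrow> space M"
    and le: "(\<Sum>t\<in>T. exp (s * S p t) + exp (- s * S p t)) \<le> 2 * card T * exp (k * (s\<^sup>2 * (b - a)\<^sup>2 / 8))"
    using exists_sample_potential_le[of T X a b k s, OF X ab] unfolding S_def by blast
  have "\<bar>(\<Sum>l<k. X t (p l)) / k - expectation (X t)\<bar> \<le> \<delta>" if "t \<in> T" for t
  proof -
    have T: "real (card T) > 0" using assms(1) that by (auto simp: card_gt_0_iff)
    \<comment> \<open>The left side is one of the two summands on the right, depending on the sign
      of \<open>S p t\<close>.\<close>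
    have "exp (s * \<bar>S p t\<bar>) \<le> exp (s * S p t) + exp (- s * S p t)"
      by (cases "S p t \<ge> 0") (auto simp: add_increasing add_increasing2)
    also have "\<dots> \<le> (\<Sum>t\<in>T. exp (s * S p t) + exp (- s * S p t))"
      using assms(1) that by (intro member_le_sum) (auto intro: add_nonneg_nonneg)
    also have "\<dots> \<le> exp (ln (2 * card T) + k * (s\<^sup>2 * (b - a)\<^sup>2 / 8))"
      using le T by (simp add: exp_add)
    finally have "s * \<bar>S p t\<bar> \<le> ln (2 * card T) + k * (s\<^sup>2 * (b - a)\<^sup>2 / 8)"
      by simp
    also have "k * (s\<^sup>2 * (b - a)\<^sup>2 / 8) = 2 * k * \<delta>\<^sup>2 / (b - a)\<^sup>2"
      using \<open>a < b\<close> by (simp add: s_def power_divide power_mult_distrib power2_eq_square)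
    also have "ln (2 * card T) \<le> 2 * k * \<delta>\<^sup>2 / (b - a)\<^sup>2"
      using k \<open>a < b\<close> by (simp add: field_simps)
    also have "2 * k * \<delta>\<^sup>2 / (b - a)\<^sup>2 + 2 * k * \<delta>\<^sup>2 / (b - a)\<^sup>2 = s * (k * \<delta>)"
      by (simp add: s_def power2_eq_square)
    finally have "\<bar>S p t\<bar> \<le> k * \<delta>"
      using \<open>s > 0\<close> by simp
    moreover have "(\<Sum>l<k. X t (p l)) / k - expectation (X t) = S p t / k"
      using \<open>0 < k\<close> by (simp add: S_def sum_subtractf field_simps)
    ultimately show ?thesis
      using \<open>0 < k\<close> by (simp add: field_simps)
  qed
  with p show ?thesis by blast
qed

end

section \<open>The unit cube as a probability space\<close>

abbreviation cube_measure :: "nat \<Rightarrow> (nat \<Rightarrow> real) measure" where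
  "cube_measure d \<equiv> restrict_space (\<Pi>\<^sub>M i\<in>{..<d}. lborel) (unit_cube d)"

lemma unit_cube_sets: "unit_cube d \<in> sets (\<Pi>\<^sub>M i\<in>{..<d}. lborel)"
  unfolding unit_cube_def by (intro sets_PiM_I_finite) auto

lemma space_cube_measure: "space (cube_measure d) = unit_cube d"
  using sets.sets_into_space[OF unit_cube_sets[of d]] by (auto simp: space_restrict_space)

lemma prob_space_cube_measure: "prob_space (cube_measure d)"
proof (rule prob_space_restrict_space[OF unit_cube_sets])
  interpret product_sigma_finite "\<lambda>_::nat. lborel :: real measure" by unfold_locales
  show "emeasure (\<Pi>\<^sub>M i\<in>{..<d}. lborel) (unit_cube d) = 1"
    unfolding unit_cube_def by (subst emeasure_PiM) auto
qed

text \<open>Continuity refers to the topology of the full type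
  \<open>nat \<Rightarrow> real\<close>, the measure to a product over \<open>{..<d}\<close>. The
  identity map links the two: it is measurable because each of its coordinates is.\<close>

lemma continuous_on_cube_measurable:
  assumes "continuous_on (unit_cube d) f"
  shows "f \<in> borel_measurable (cube_measure d)"
proof -
  have "(\<lambda>x. x) \<in> measurable (\<Pi>\<^sub>M i\<in>{..<d}. lborel) (borel :: (nat \<Rightarrow> real) measure)"
  proof (rule measurable_coordinatewise_then_product)
    fix i :: nat
    show "(\<lambda>x :: nat \<Rightarrow> real. x i) \<in> borel_measurable (\<Pi>\<^sub>M i\<in>{..<d}. lborel)"
    proof (cases "i < d")
      case True
      then show ?thesis
        using measurable_component_singleton[of i "{..<d}" "\<lambda>_. lborel"] by simp
    next
      case False
      \<comment> \<open>Points of the product space are extensional, so every coordinate from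
        \<open>d\<close> on is a constant function.\<close>
      then have "x i = undefined" if "x \<in> space (\<Pi>\<^sub>M i\<in>{..<d}. lborel)" for x :: "nat \<Rightarrow> real"
        using that by (auto simp: space_PiM PiE_def extensional_def)
      then show ?thesis
        by (subst measurable_cong[of _ _ "\<lambda>_. undefined"]) auto
    qed
  qed
  then have "(\<lambda>x. x) \<in> measurable (cube_measure d) (restrict_space borel (unit_cube d))"
    by (rule measurable_restrict_space3) auto
  from measurable_compose[OF this borel_measurable_continuous_on_restrict[OF assms]]
  show ?thesis .
qed

lemma sq_L2_dist_eq_expectation:
  "sq_L2_dist d f g = (LINT x | cube_measure d. (f x - g x)\<^sup>2)"
  unfolding sq_L2_dist_def set_lebesgue_integral_def
  by (subst integral_restrict_space)
     (use sets.sets_into_space[OF unit_cube_sets[of d]] unit_cube_sets[of d] in \<open>auto simp: Int_absorb2\<close>)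

section \<open>The encoder and the number of samples\<close>

definition sample_enc :: "nat \<Rightarrow> (nat \<Rightarrow> 'a) \<Rightarrow> ('a \<Rightarrow> real) \<Rightarrow> nat \<Rightarrow> real" where
  "sample_enc k p f = (\<lambda>l\<in>{..<k}. f (p l) / sqrt k)"

text \<open>The sample points must lie in the cube: there the restricted pointwise operations on
  functions agree with the unrestricted ones.\<close>

lemma linear_enc_sample_enc:
  assumes "p \<in> {..<k} \<rightarrow> unit_cube d"
  shows "linear_enc d k (sample_enc k p)"
  using assms by (auto simp: linear_enc_def sample_enc_def fun_eq_iff add_divide_distrib Pi_iff)

lemma euclid_dist_sample_enc:
  "(euclid_dist k (sample_enc k p f) (sample_enc k p g))\<^sup>2 = (\<Sum>l<k. (f (p l) - g (p l))\<^sup>2) / k"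
proof -
  have "(euclid_dist k (sample_enc k p f) (sample_enc k p g))\<^sup>2
      = (\<Sum>l<k. (sample_enc k p f l - sample_enc k p g l)\<^sup>2)"
    by (simp add: euclid_dist_def L2_set_def sum_nonneg)
  also have "\<dots> = (\<Sum>l<k. (f (p l) - g (p l))\<^sup>2 / k)"
    by (intro sum.cong) (auto simp: sample_enc_def power_divide simp flip: diff_divide_distrib)
  finally show ?thesis by (simp add: sum_divide_distrib)
qed

text \<open>The last inequality is the condition of \<open>exists_sample_mean_close\<close> for
  \<open>n\<^sup>2\<close> pairs, range \<open>[0, 4]\<close> and error \<open>\<epsilon>\<close>:
  \<open>16 * ln (2 * n\<^sup>2) \<le> 2 * k * \<epsilon>\<^sup>2\<close>, halved.\<close>

lemma exists_sample_size:
  fixes \<epsilon> :: real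
  assumes "n \<ge> 8" "0 < \<epsilon>" "\<epsilon> < 1"
  obtains k :: nat where "k \<ge> 1" "real k \<le> 25 * (ln (real n) / \<epsilon>\<^sup>2)"
    "8 * ln (2 * (real n)\<^sup>2) \<le> k * \<epsilon>\<^sup>2"
proof
  define L where "L = ln (real n)"
  \<comment> \<open>The constant is \<open>24 = 8 * 3\<close>, since
    \<open>ln (2 * n\<^sup>2) = ln 2 + 2 * L \<le> 3 * L\<close>.\<close>
  define k where "k = nat \<lceil>24 * (L / \<epsilon>\<^sup>2)\<rceil>"
  have "exp (1::real) \<le> n"
    using e_less_272 assms(1) by linarith
  then have "L \<ge> 1"
    using assms(1) by (simp add: L_def ln_ge_iff)
  have "\<epsilon>\<^sup>2 < 1"
    using assms(2,3) by (simp add: power_less_one_iff)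
  \<comment> \<open>Rounding up costs at most 1, which this bound absorbs by raising 24 to
    25.\<close>
  then have L: "L / \<epsilon>\<^sup>2 \<ge> 1"
    using \<open>L \<ge> 1\<close> assms(2) by simp
  have k: "24 * (L / \<epsilon>\<^sup>2) \<le> k" "k \<le> 24 * (L / \<epsilon>\<^sup>2) + 1"
    using L unfolding k_def by linarith+
  show "k \<ge> 1" "real k \<le> 25 * (ln (real n) / \<epsilon>\<^sup>2)"
    using k L by (auto simp flip: L_def)
  have "ln (2 * (real n)\<^sup>2) = ln 2 + 2 * L"
    using assms(1) by (simp add: ln_mult ln_realpow L_def)
  also have "ln 2 \<le> L"
    using assms(1) by (simp add: L_def)
  also have "8 * (L + 2 * L) \<le> k * \<epsilon>\<^sup>2"
    using k(1) assms(2) by (simp add: field_simps)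
  finally show "8 * ln (2 * (real n)\<^sup>2) \<le> k * \<epsilon>\<^sup>2" by simp
qed

theorem theorem1p1:
  "\<exists>C::real. C > 0 \<and>
     (\<forall>(d::nat) (n::nat) (f :: nat \<Rightarrow> (nat \<Rightarrow> real) \<Rightarrow> real).
        d \<ge> 1 \<longrightarrow> n \<ge> 8 \<longrightarrow>
        (\<forall>i\<in>{1..n}. f i \<in> cont_cube d \<and> f i ` unit_cube d \<subseteq> {-1..1}) \<longrightarrow>
        (\<forall>\<epsilon>::real. 0 < \<epsilon> \<and> \<epsilon> < 1 \<longrightarrow>
           (\<exists>(k::nat) (Enc :: ((nat \<Rightarrow> real) \<Rightarrow> real) \<Rightarrow> nat \<Rightarrow> real)
               (Dec :: (nat \<Rightarrow> real) \<times> (nat \<Rightarrow> real) \<Rightarrow> real).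
              k \<ge> 1 \<and> real k \<le> C * (ln (real n) / \<epsilon>\<^sup>2) \<and>
              Enc \<in> cont_cube d \<rightarrow> real_vecs k \<and>
              (\<forall>i\<in>{1..n}. \<forall>j\<in>{1..n}.
                 \<bar>Dec (Enc (f i), Enc (f j)) - sq_L2_dist d (f i) (f j)\<bar> \<le> \<epsilon>) \<and>
              (\<forall>u\<in>real_vecs k. \<forall>v\<in>real_vecs k. Dec (u, v) = (euclid_dist k u v)\<^sup>2) \<and>
              linear_enc d k Enc)))"
proof (rule exI[of _ 25], intro conjI allI impI)
  fix d n :: nat and f :: "nat \<Rightarrow> (nat \<Rightarrow> real) \<Rightarrow> real" and \<epsilon> :: real
  assume "n \<ge> 8" and f: "\<forall>i\<in>{1..n}. f i \<in> cont_cube d \<and> f i ` unit_cube d \<subseteq> {-1..1}"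
    and \<epsilon>: "0 < \<epsilon> \<and> \<epsilon> < 1"
  obtain k :: nat where k: "k \<ge> 1" "real k \<le> 25 * (ln (real n) / \<epsilon>\<^sup>2)"
    "8 * ln (2 * (real n)\<^sup>2) \<le> k * \<epsilon>\<^sup>2"
    using exists_sample_size \<open>n \<ge> 8\<close> \<epsilon> by metis
  interpret prob_space "cube_measure d" by (rule prob_space_cube_measure)
  \<comment> \<open>The variables are indexed by pairs, so that a single sample serves all
    \<open>i\<close> and \<open>j\<close>; the mean of \<open>X (i, j)\<close> is
    \<open>sq_L2_dist d (f i) (f j)\<close>.\<close>
  define X where "X = (\<lambda>(i, j) x. (f i x - f j x)\<^sup>2)"
  define T where "T = {1..n} \<times> {1..n}"
  have "\<exists>p\<in>{..<k} \<rightarrow> space (cube_measure d).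
      \<forall>t\<in>T. \<bar>(\<Sum>l<k. X t (p l)) / k - expectation (X t)\<bar> \<le> \<epsilon>"
  proof (rule exists_sample_mean_close)
    show "X t \<in> borel_measurable (cube_measure d)" if "t \<in> T" for t
      using that f unfolding X_def T_def cont_cube_def
      by (auto intro!: continuous_on_cube_measurable continuous_intros)
    show "X t x \<in> {0..4}" if "t \<in> T" "x \<in> space (cube_measure d)" for t x
    proof -
      obtain i j where t: "t = (i, j)" "i \<in> {1..n}" "j \<in> {1..n}"
        using \<open>t \<in> T\<close> by (auto simp: T_def)
      then have "f i x \<in> {-1..1}" "f j x \<in> {-1..1}"
        using f that(2) unfolding space_cube_measure by blast+
      then have "\<bar>f i x - f j x\<bar> \<le> 2" by auto
      then have "(f i x - f j x)\<^sup>2 \<le> 2\<^sup>2"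
        by (subst abs_le_square_iff[symmetric]) simp
      then show ?thesis by (simp add: X_def t)
    qed
  \<comment> \<open>Here \<open>card T = n\<^sup>2\<close> and \<open>(b - a)\<^sup>2 = 16\<close>,
    so the remaining size condition is twice the last inequality in \<open>k\<close>.\<close>
  qed (use k \<epsilon> in \<open>auto simp: T_def power2_eq_square mult_ac\<close>)
  then obtain p where p: "p \<in> {..<k} \<rightarrow> unit_cube d"
    and close: "\<And>t. t \<in> T \<Longrightarrow> \<bar>(\<Sum>l<k. X t (p l)) / k - expectation (X t)\<bar> \<le> \<epsilon>"
    unfolding space_cube_measure by blast
  define Dec where "Dec = (\<lambda>(u, v). (euclid_dist k u v)\<^sup>2)"
  have "\<bar>Dec (sample_enc k p (f i), sample_enc k p (f j)) - sq_L2_dist d (f i) (f j)\<bar> \<le> \<epsilon>"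
    if "i \<in> {1..n}" "j \<in> {1..n}" for i j
    using close[of "(i, j)"] that
    by (simp add: Dec_def euclid_dist_sample_enc sq_L2_dist_eq_expectation X_def T_def)
  moreover have "sample_enc k p \<in> cont_cube d \<rightarrow> real_vecs k"
    by (auto simp: sample_enc_def real_vecs_def)
  moreover have "\<forall>u\<in>real_vecs k. \<forall>v\<in>real_vecs k. Dec (u, v) = (euclid_dist k u v)\<^sup>2"
    by (simp add: Dec_def)
  ultimately show "\<exists>(k::nat) (Enc :: ((nat \<Rightarrow> real) \<Rightarrow> real) \<Rightarrow> nat \<Rightarrow> real)
      (Dec :: (nat \<Rightarrow> real) \<times> (nat \<Rightarrow> real) \<Rightarrow> real).
      k \<ge> 1 \<and> real k \<le> 25 * (ln (real n) / \<epsilon>\<^sup>2) \<and>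
      Enc \<in> cont_cube d \<rightarrow> real_vecs k \<and>
      (\<forall>i\<in>{1..n}. \<forall>j\<in>{1..n}.
         \<bar>Dec (Enc (f i), Enc (f j)) - sq_L2_dist d (f i) (f j)\<bar> \<le> \<epsilon>) \<and>
      (\<forall>u\<in>real_vecs k. \<forall>v\<in>real_vecs k. Dec (u, v) = (euclid_dist k u v)\<^sup>2) \<and>
      linear_enc d k Enc"
    using k(1,2) linear_enc_sample_enc[OF p] by blast
qed simp

end
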